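(* Let $\delta:=f(x)D_{d_1,P_1;d_2,P_2}$, where $f(x)=\sum_{i=0}^{l}a_ix^{n_i}\in k[x]$ with $l\in\mathbb{N}\cup\{0\}$, $n_0,\dots,n_l\in\mathbb{N}\cup\{0\}$ pairwise distinct and $a_i\in k^*$ for each $i$. Suppose $\alpha\in\mathrm{Aut}(B_{d_1,P_1;d_2,P_2})$ with $\alpha(x)=\lambda x$ and $\alpha(y_1)=ay_1+b(x)$, for some $\lambda,a\in k^*$ and $b(x)\in k[x]$. Then the following are equivalent. (i) $\alpha\in\mathrm{Aut}(\delta)$. (ii) $\delta\alpha(y_1)=\alpha\delta(y_1)$. (iii) $\delta\alpha(y_2)=\alpha\delta(y_2)$. (iv) $a=\lambda^{d_1+d_2+n_0}=\lambda^{d_1+d_2+n_i}$ for all $i$, $1\leqslant i\leqslant l$. In particular, if $\delta=D_{d_1,P_1;d_2,P_2}$, then $\alpha\in\mathrm{Aut}(\delta)$ if and only if $a=\lambda^{d_1+d_2}$.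
   Context: $k$ is a field of characteristic zero. A Double Danielewski surface over $k$ is the $k$-algebra $$B_{d_1,P_1;d_2,P_2}=k[X,Y_1,Y_2,Y_3]/\big(X^{d_1}Y_2-P_1(X,Y_1),\;X^{d_2}Y_3-P_2(X,Y_1,Y_2)\big),$$ where for $i=1,2$: $d_i\geqslant 2$, $P_i$ is monic in $Y_i$ and $\deg_{Y_i}(P_i)\geqslant 2$ (with $P_1\in k[X,Y_1]$, $P_2\in k[X,Y_1,Y_2]$). Let $x,y_1,y_2,y_3$ be the images of $X,Y_1,Y_2,Y_3$. The canonical locally nilpotent derivation is $$D_{d_1,P_1;d_2,P_2}=x^{d_1+d_2}\frac{\partial}{\partial y_1}+x^{d_2}\frac{\partial P_1}{\partial y_1}\frac{\partial}{\partial y_2}+\Big(\frac{\partial P_2}{\partial y_1}x^{d_1}+\frac{\partial P_2}{\partial y_2}\frac{\partial P_1}{\partial y_1}\Big)\frac{\partial}{\partial y_3},$$ i.e. it kills $x$ and sends $y_1,y_2,y_3$ to the displayed coefficients. $\mathrm{Aut}(B)$ is the group of $k$-algebra automorphisms of $B$ and $\mathrm{Aut}(\delta)=\{\sigma\in\mathrm{Aut}(B):\sigma\delta=\delta\sigma\}$. *)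

theory Defs
  imports "HOL-Algebra.Algebraic_Closure_Type"
begin

text \<open>
  The polynomial ring \<open>k[X,Y\<^sub>1,Y\<^sub>2,Y\<^sub>3]\<close> is the iterated univariate polynomial ring
  \<open>k[X][Y\<^sub>1][Y\<^sub>2][Y\<^sub>3]\<close>, so the innermost variable is \<open>X\<close> and the outermost one is \<open>Y\<^sub>3\<close>.
  Likewise \<open>P\<^sub>1 \<in> k[X][Y\<^sub>1]\<close> and \<open>P\<^sub>2 \<in> k[X][Y\<^sub>1][Y\<^sub>2]\<close>.
\<close>

type_synonym 'a poly2 = "'a poly poly"
type_synonym 'a poly3 = "'a poly poly poly"
type_synonym 'a poly4 = "'a poly poly poly poly"

abbreviation (input) of_polyX :: "'a::field poly \<Rightarrow> 'a poly4" where "of_polyX p \<equiv> [:[:[:p:]:]:]"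
abbreviation (input) of_poly2 :: "'a::field poly2 \<Rightarrow> 'a poly4" where "of_poly2 p \<equiv> [:[:p:]:]"
abbreviation (input) of_poly3 :: "'a::field poly3 \<Rightarrow> 'a poly4" where "of_poly3 p \<equiv> [:p:]"

abbreviation varX  :: "'a::field poly4" where "varX  \<equiv> [:[:[:[:0, 1:]:]:]:]"
abbreviation varY1 :: "'a::field poly4" where "varY1 \<equiv> [:[:[:0, 1:]:]:]"
abbreviation varY2 :: "'a::field poly4" where "varY2 \<equiv> [:[:0, 1:]:]"
abbreviation varY3 :: "'a::field poly4" where "varY3 \<equiv> [:0, 1:]"

definition dd_ideal :: "nat \<Rightarrow> 'a::field poly2 \<Rightarrow> nat \<Rightarrow> 'a poly3 \<Rightarrow> 'a poly4 set" where
  "dd_ideal d1 P1 d2 P2 =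
     Idl\<^bsub>ring_of_type_algebra\<^esub> {varX ^ d1 * varY2 - of_poly2 P1, varX ^ d2 * varY3 - of_poly3 P2}"

definition dd_surface :: "nat \<Rightarrow> 'a::field poly2 \<Rightarrow> nat \<Rightarrow> 'a poly3 \<Rightarrow> 'a poly4 set ring" where
  "dd_surface d1 P1 d2 P2 = ring_of_type_algebra Quot dd_ideal d1 P1 d2 P2"

definition dd_class :: "nat \<Rightarrow> 'a::field poly2 \<Rightarrow> nat \<Rightarrow> 'a poly3 \<Rightarrow> 'a poly4 \<Rightarrow> 'a poly4 set" where
  "dd_class d1 P1 d2 P2 p = dd_ideal d1 P1 d2 P2 +>\<^bsub>ring_of_type_algebra\<^esub> p"

text \<open>
  The lift of the canonical derivation to \<open>k[X,Y\<^sub>1,Y\<^sub>2,Y\<^sub>3]\<close>, with the three summands of the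
  defining formula. On \<open>k[X][Y\<^sub>1][Y\<^sub>2][Y\<^sub>3]\<close>, the operators \<open>pderiv\<close>, \<open>map_poly pderiv\<close> and
  \<open>map_poly (map_poly pderiv)\<close> are the partial derivatives with respect to \<open>Y\<^sub>3\<close>, \<open>Y\<^sub>2\<close> and
  \<open>Y\<^sub>1\<close>; similarly for \<open>P\<^sub>1\<close> and \<open>P\<^sub>2\<close>, with respect to their own variables.
\<close>

definition dd_lift :: "nat \<Rightarrow> 'a::field poly2 \<Rightarrow> nat \<Rightarrow> 'a poly3 \<Rightarrow> 'a poly4 \<Rightarrow> 'a poly4" where
  "dd_lift d1 P1 d2 P2 p =
     varX ^ (d1 + d2) * map_poly (map_poly pderiv) p
   + varX ^ d2 * of_poly2 (pderiv P1) * map_poly pderiv p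
   + (of_poly3 (map_poly pderiv P2) * varX ^ d1 + of_poly3 (pderiv P2) * of_poly2 (pderiv P1))
       * pderiv p"

text \<open>
  The induced map on the quotient; it does not depend on the representative, see
  \<open>dd_lnd_class\<close> below.
\<close>

definition dd_lnd :: "nat \<Rightarrow> 'a::field poly2 \<Rightarrow> nat \<Rightarrow> 'a poly3 \<Rightarrow> 'a poly4 set \<Rightarrow> 'a poly4 set" where
  "dd_lnd d1 P1 d2 P2 u = the_elem ((\<lambda>p. dd_class d1 P1 d2 P2 (dd_lift d1 P1 d2 P2 p)) ` u)"

text \<open>
  Automorphisms over \<open>k\<close> are the ring automorphisms fixing the image of \<open>k\<close>. They are taken to be
  extensional (\<open>undefined\<close> off the carrier), so that each one is represented by exactly
  one HOL function.
\<close>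

definition dd_Aut :: "nat \<Rightarrow> 'a::field poly2 \<Rightarrow> nat \<Rightarrow> 'a poly3 \<Rightarrow> ('a poly4 set \<Rightarrow> 'a poly4 set) set" where
  "dd_Aut d1 P1 d2 P2 =
     {\<sigma> \<in> ring_iso (dd_surface d1 P1 d2 P2) (dd_surface d1 P1 d2 P2)
          \<inter> extensional (carrier (dd_surface d1 P1 d2 P2)).
        \<forall>c. \<sigma> (dd_class d1 P1 d2 P2 (of_polyX [:c:])) = dd_class d1 P1 d2 P2 (of_polyX [:c:])}"

definition dd_Aut_der :: "nat \<Rightarrow> 'a::field poly2 \<Rightarrow> nat \<Rightarrow> 'a poly3 \<Rightarrow>
    ('a poly4 set \<Rightarrow> 'a poly4 set) \<Rightarrow> ('a poly4 set \<Rightarrow> 'a poly4 set) set" where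
  "dd_Aut_der d1 P1 d2 P2 \<delta> =
     {\<sigma> \<in> dd_Aut d1 P1 d2 P2. \<forall>u \<in> carrier (dd_surface d1 P1 d2 P2). \<sigma> (\<delta> u) = \<delta> (\<sigma> u)}"


lemma map_poly_derivation:
  fixes d :: "'b::idom \<Rightarrow> 'b"
  assumes add: "\<And>x y. d (x + y) = d x + d y"
    and leib: "\<And>x y. d (x * y) = x * d y + d x * y"
  shows "map_poly d (p + q) = map_poly d p + map_poly d q"
    and "map_poly d (p * q) = p * map_poly d q + map_poly d p * q"
proof -
  have z: "d 0 = 0" using add[of 0 0] by (metis add_0 add_cancel_right_right)
  have s: "d (sum g A) = (\<Sum>i\<in>A. d (g i))" if "finite A" for g :: "nat \<Rightarrow> 'b" and A
    using that by induction (auto simp: z add)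
  show "map_poly d (p + q) = map_poly d p + map_poly d q"
    by (rule poly_eqI) (simp add: coeff_map_poly z add)
  show "map_poly d (p * q) = p * map_poly d q + map_poly d p * q"
    by (rule poly_eqI) (simp add: coeff_map_poly z coeff_mult s leib sum.distrib)
qed

lemma dd_lift_add: "dd_lift d1 P1 d2 P2 (p + q) = dd_lift d1 P1 d2 P2 p + dd_lift d1 P1 d2 P2 q"
  and dd_lift_mult:
    "dd_lift d1 P1 d2 P2 (p * q) = p * dd_lift d1 P1 d2 P2 q + dd_lift d1 P1 d2 P2 p * q"
proof -
  have pl: "pderiv (x * y) = x * pderiv y + pderiv x * y" for x y :: "'b::idom poly"
    by (simp add: pderiv_mult mult.commute)
  note d1 = map_poly_derivation[of pderiv, OF pderiv_add pl]
  note d2 = map_poly_derivation[of "map_poly pderiv", OF d1]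
  show "dd_lift d1 P1 d2 P2 (p + q) = dd_lift d1 P1 d2 P2 p + dd_lift d1 P1 d2 P2 q"
    unfolding dd_lift_def d1 d2 pderiv_add by (simp only: distrib_left distrib_right ac_simps)
  show "dd_lift d1 P1 d2 P2 (p * q) = p * dd_lift d1 P1 d2 P2 q + dd_lift d1 P1 d2 P2 p * q"
    unfolding dd_lift_def d1 d2 pl by (simp only: distrib_left distrib_right ac_simps)
qed

lemma dd_lift_consts:
  "dd_lift d1 P1 d2 P2 (of_polyX p) = 0"
  "dd_lift d1 P1 d2 P2 (of_poly2 q) = varX ^ (d1 + d2) * of_poly2 (pderiv q)"
  "dd_lift d1 P1 d2 P2 (of_poly3 r) =
     varX ^ (d1 + d2) * of_poly3 (map_poly pderiv r) + varX ^ d2 * of_poly2 (pderiv P1) * of_poly3 (pderiv r)"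
  by (simp_all add: dd_lift_def map_poly_pCons pderiv_pCons)

lemma dd_lift_vars:
  "dd_lift d1 P1 d2 P2 varX = 0"
  "dd_lift d1 P1 d2 P2 varY1 = varX ^ (d1 + d2)"
  "dd_lift d1 P1 d2 P2 varY2 = varX ^ d2 * of_poly2 (pderiv P1)"
  "dd_lift d1 P1 d2 P2 varY3 =
     of_poly3 (map_poly pderiv P2) * varX ^ d1 + of_poly3 (pderiv P2) * of_poly2 (pderiv P1)"
  by (simp_all add: dd_lift_def map_poly_pCons pderiv_pCons map_poly_1 flip: one_pCons)

lemma dd_lnd_class:
  "dd_lnd d1 P1 d2 P2 (dd_class d1 P1 d2 P2 p) = dd_class d1 P1 d2 P2 (dd_lift d1 P1 d2 P2 p)"
proof -
  let ?R = "ring_of_type_algebra :: 'a poly4 ring" and ?I = "dd_ideal d1 P1 d2 P2"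
  let ?D = "dd_lift d1 P1 d2 P2"
  let ?G = "{varX ^ d1 * varY2 - of_poly2 P1, varX ^ d2 * varY3 - of_poly3 P2}"
  interpret cring ?R by (rule cring_from_type_algebra)
  have R: "carrier ?R = UNIV" "\<And>x y. x \<oplus>\<^bsub>?R\<^esub> y = x + y" "\<And>x y. x \<otimes>\<^bsub>?R\<^esub> y = x * y" "\<zero>\<^bsub>?R\<^esub> = 0"
    by (simp_all add: ring_of_type_algebra_def)
  interpret I: ideal ?I ?R unfolding dd_ideal_def by (rule genideal_ideal) (simp add: R)
  have add: "x + y \<in> ?I" if "x \<in> ?I" "y \<in> ?I" for x y using I.a_closed[OF that] by (simp add: R)
  have mult: "x * y \<in> ?I" if "y \<in> ?I" for x y using I.I_l_closed[OF that, of x] by (simp add: R)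
  have multr: "y * x \<in> ?I" if "y \<in> ?I" for x y using I.I_r_closed[OF that, of x] by (simp add: R)
  have D0: "?D 0 = 0" using dd_lift_add[of d1 P1 d2 P2 0 0] by (metis add_0 add_cancel_right_right)
  have zero: "0 \<in> ?I" using I.zero_closed by (simp add: R)
  have minus: "- x \<in> ?I" if "x \<in> ?I" for x using mult[OF that, of "-1"] by simp
  have Dm: "?D (- x) = - ?D x" for x using dd_lift_add[of d1 P1 d2 P2 x "-x"] D0
    by (simp add: eq_neg_iff_add_eq_0 add.commute)
  have Dpow: "?D (varX ^ n) = 0" for n
  proof (induction n)
    case 0
    show ?case using dd_lift_mult[of d1 P1 d2 P2 1 1]
      by (metis add_cancel_right_right mult_1 mult.right_neutral power_0)
  next
    case (Suc n)
    show ?case unfolding power_Suc dd_lift_mult Suc dd_lift_vars by simp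
  qed
  have Ddiff: "?D (x - y) = ?D x - ?D y" for x y
    unfolding diff_conv_add_uminus dd_lift_add Dm ..
  have "?D (varX ^ d1 * varY2 - of_poly2 P1) = 0"
    unfolding Ddiff dd_lift_mult Dpow dd_lift_vars(3) dd_lift_consts(2)[where q = P1] power_add
    by (simp only: mult_zero_left add_0_right mult.assoc diff_self)
  moreover have "?D (varX ^ d2 * varY3 - of_poly3 P2) = 0"
    unfolding Ddiff dd_lift_mult Dpow dd_lift_vars(4) dd_lift_consts(3)[where r = P2] power_add
    by (simp only: mult_zero_left add_0_left add_0_right distrib_left ac_simps diff_self)
  ultimately have gens: "?D g = 0" if "g \<in> ?G" for g
    using that by blast
  let ?J = "{q \<in> ?I. ?D q \<in> ?I}"
  have "ideal ?J ?R"
  proof (rule idealI)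
    show "ring ?R" by (rule ring_axioms)
    have inv: "\<ominus>\<^bsub>?R\<^esub> x = - x" for x :: "'a poly4"
      by (rule minus_equality) (simp_all add: R)
    show "subgroup ?J (add_monoid ?R)"
    proof (rule add.subgroupI)
      show "?J \<subseteq> carrier ?R" unfolding R by simp
      show "?J \<noteq> {}" using zero D0 by force
      show "\<ominus>\<^bsub>?R\<^esub> x \<in> ?J" if "x \<in> ?J" for x
        using that unfolding inv by (simp add: minus Dm)
      show "x \<oplus>\<^bsub>?R\<^esub> y \<in> ?J" if "x \<in> ?J" "y \<in> ?J" for x y
        using that unfolding R by (simp add: add dd_lift_add)
    qed
    show "x \<otimes>\<^bsub>?R\<^esub> a \<in> ?J" if "a \<in> ?J" for a x
      using that by (auto simp: R dd_lift_mult intro!: add mult)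
    show "a \<otimes>\<^bsub>?R\<^esub> x \<in> ?J" if "a \<in> ?J" for a x
      using that by (auto simp: R dd_lift_mult intro!: add mult multr)
  qed
  moreover have "?G \<subseteq> ?J"
    using gens zero genideal_self[of ?G] unfolding dd_ideal_def[symmetric] R by auto
  ultimately have "?I \<subseteq> ?J"
    unfolding dd_ideal_def by (intro genideal_minimal)
  then have DI: "?D q \<in> ?I" if "q \<in> ?I" for q using that by auto
  have mem: "x \<in> dd_class d1 P1 d2 P2 y \<longleftrightarrow> x - y \<in> ?I" for x y
    unfolding dd_class_def a_r_coset_def' R by (auto intro: bexI[of _ "x - y"])
  have eq: "dd_class d1 P1 d2 P2 x = dd_class d1 P1 d2 P2 y" if "x - y \<in> ?I" for x y
  proof (rule Set.set_eqI)
    fix w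
    show "w \<in> dd_class d1 P1 d2 P2 x \<longleftrightarrow> w \<in> dd_class d1 P1 d2 P2 y"
      unfolding mem using add[of "w - x" "x - y"] add[of "w - y" "- (x - y)"] minus[of "x - y"] that
      by (auto simp only: diff_add_cancel add_diff_eq diff_minus_eq_add minus_diff_eq)
  qed
  have "?D q - ?D p \<in> ?I" if "q \<in> dd_class d1 P1 d2 P2 p" for q
    using DI[of "q - p"] that unfolding mem Ddiff by blast
  moreover have "p \<in> dd_class d1 P1 d2 P2 p"
    unfolding mem using zero by (simp only: diff_self)
  ultimately show ?thesis
    unfolding dd_lnd_def by (intro the_elem_image_unique eq) auto
qed

end

(*
  Inverting x turns B into k[x, 1/x, y1], and x is a nonzerodivisor of B because (P1, P2) is a
  regular sequence modulo X; so B embeds into the fraction field of k[X, Y1]. The commutator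
  E = alpha delta - delta alpha is a derivation along alpha that kills k[x]. Applying E to
  x^d1 y2 = P1(x, y1) shows that E(y2) is a nonzero multiple of E(y1), and applying it to
  x^d2 y3 = P2(x, y1, y2) that E(y3) = 0 as soon as E(y1) = E(y2) = 0. Hence E vanishes iff E(y1)
  does, and E(y1) = 0 is an identity of polynomials in x, to be read off coefficientwise.
*)
theory Submission
  imports Defs
begin

section \<open>Syzygies modulo x and division by x\<close>

text \<open>Since \<open>p\<close> is a nonzerodivisor modulo \<open>x\<close> and \<open>P\<close>
  is monic, \<open>p\<close>, \<open>P\<close> is a regular sequence modulo \<open>x\<close>, so
  their only relations there are multiples of the Koszul relation \<open>(P, - p)\<close>. The
  induction lowers a degree bound on \<open>C\<close>: subtracting such multiples reduces to
  \<open>C = 0\<close>, where \<open>x\<close> divides \<open>p\<close> times each coefficient of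
  \<open>A\<close>, hence \<open>A\<close> itself.\<close>

lemma syzygy_mod_const:
  fixes x p :: "'r::idom" and A C P :: "'r poly"
  assumes reg: "\<And>r. x dvd p * r \<Longrightarrow> x dvd r"
    and monic: "lead_coeff P = 1"
    and dvd: "[:x:] dvd smult p A + C * P"
  shows "\<exists>Q. [:x:] dvd A - P * Q \<and> [:x:] dvd C + smult p Q"
proof -
  have "\<exists>Q. [:x:] dvd A - P * Q \<and> [:x:] dvd C + smult p Q"
    if "\<forall>i\<ge>m. coeff C i = 0" "[:x:] dvd smult p A + C * P" for m
    using that
  proof (induction m arbitrary: A C)
    case 0
    then have "C = 0" by (auto intro: poly_eqI)
    with 0 have "[:x:] dvd A" by (auto simp: const_poly_dvd_iff intro: reg)
    with \<open>C = 0\<close> show ?case by (intro exI[of _ 0]) simp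
  next
    case (Suc m)
    define g where "g = coeff A (m + degree P)"
    have "degree C \<le> m" using Suc.prems(1) by (auto intro: degree_le)
    \<comment> \<open>The position \<open>m + degree P\<close> is the top one possible for the
      product, and \<open>P\<close> is monic.\<close>
    then have "coeff (C * P) (m + degree P) = coeff C m"
    proof (cases "degree C = m")
      case True
      then show ?thesis using monic by (metis coeff_mult_degree_sum mult.right_neutral)
    next
      case False
      with \<open>degree C \<le> m\<close> have "degree (C * P) < m + degree P"
        by (meson add_less_mono1 degree_mult_le le_neq_implies_less le_less_trans)
      with False \<open>degree C \<le> m\<close> show ?thesis by (simp add: coeff_eq_0)
    qed
    with Suc.prems(2) have "x dvd p * g + coeff C m"
      unfolding const_poly_dvd_iff g_def by (metis coeff_add coeff_smult)
    then obtain r where r: "p * g + coeff C m = x * r" by blast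
    \<comment> \<open>Adding the Koszul multiple turns coefficient \<open>m\<close> of
      \<open>C\<close> into \<open>x * r\<close>. Removing this term as well makes it exactly zero,
      at the price of a multiple of \<open>[:x:]\<close>, which does not affect the
      divisibility.\<close>
    define C' where "C' = C + smult p (monom g m) - monom (x * r) m"
    define A' where "A' = A - P * monom g m"
    have *: "P * monom (g * p) m = smult p (P * monom g m)"
      by (metis mult.commute mult_smult_right smult_monom)
    have "coeff C' i = 0" if "i \<ge> m" for i
      using that Suc.prems(1) r by (cases "i = m") (auto simp: C'_def add.commute)
    moreover have "smult p A' + C' * P = smult p A + C * P - [:x:] * (monom r m * P)"
      by (simp add: A'_def C'_def * algebra_simps smult_diff_right smult_monom smult_add_right
          flip: smult_monom[of x r])
    then have "[:x:] dvd smult p A' + C' * P" using Suc.prems(2) by (simp only: dvd_diff dvd_triv_left)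
    ultimately obtain Q where "[:x:] dvd A' - P * Q" "[:x:] dvd C' + smult p Q"
      using Suc.IH by blast
    then have "[:x:] dvd A - P * (Q + monom g m)"
      "[:x:] dvd (C' + smult p Q) + [:x:] * monom r m"
      by (simp add: A'_def algebra_simps) (simp only: dvd_add dvd_triv_left \<open>[:x:] dvd C' + smult p Q\<close>)
    moreover have "(C' + smult p Q) + [:x:] * monom r m = C + smult p (Q + monom g m)"
      by (simp add: C'_def smult_monom smult_add_right)
    ultimately show ?case by metis
  qed
  from this[of "Suc (degree C)"] dvd show ?thesis by (simp add: coeff_eq_0)
qed

text \<open>Neither \<open>p\<close> nor \<open>P\<close> involves the outer variable, so the
  relation splits into one relation for each coefficient in that variable. In the application this
  variable is Y3.\<close>

lemma syzygy_mod_const2: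
  fixes x p :: "'r::idom" and A C :: "'r poly poly" and P :: "'r poly"
  assumes reg: "\<And>r. x dvd p * r \<Longrightarrow> x dvd r"
    and monic: "lead_coeff P = 1"
    and dvd: "[:[:x:]:] dvd [:[:p:]:] * A + C * [:P:]"
  shows "\<exists>Q. [:[:x:]:] dvd A - [:P:] * Q \<and> [:[:x:]:] dvd C + [:[:p:]:] * Q"
proof -
  have "\<exists>Q. [:x:] dvd coeff A j - P * Q \<and> [:x:] dvd coeff C j + smult p Q" for j
    using dvd by (intro syzygy_mod_const[OF reg monic]) (auto simp: const_poly_dvd_iff[of "[:x:]"] mult.commute)
  then obtain q where q: "\<And>j. [:x:] dvd coeff A j - P * q j" "\<And>j. [:x:] dvd coeff C j + smult p (q j)"
    by metis
  \<comment> \<open>The quotients \<open>q j\<close> are arbitrary choices, so they are cut off at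
    \<open>N\<close> to form a polynomial; beyond \<open>N\<close> the coefficients of
    \<open>A\<close> and \<open>C\<close> vanish and the quotient 0 works.\<close>
  define N where "N = max (degree A) (degree C)"
  define Q where "Q = (\<Sum>j\<le>N. monom (q j) j)"
  have Q: "coeff Q j = (if j \<le> N then q j else 0)" for j
    by (simp add: Q_def coeff_sum)
  have "coeff A j = 0" "coeff C j = 0" if "\<not> j \<le> N" for j
    using that by (auto simp: N_def coeff_eq_0)
  with q show ?thesis
    by (intro exI[of _ Q]) (auto simp: const_poly_dvd_iff[of "[:x:]"] Q)
qed

text \<open>Modulo \<open>x\<close> the equation is a syzygy of \<open>p1\<close> and
  \<open>p2\<close>, so \<open>(A, C)\<close> is a multiple of \<open>(p2, - p1)\<close> plus a
  multiple of \<open>x\<close>. The Koszul part is harmless: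
  \<open>p2 * (x * u - p1) - p1 * (x * v - p2)\<close> equals
  \<open>x * (v * (x * u - p1) - u * (x * v - p2))\<close>, so division by \<open>x\<close> stays
  inside the ideal.\<close>

lemma koszul_division:
  fixes x :: "'r::idom"
  assumes syz: "\<And>A C. x dvd p1 * A + C * p2 \<Longrightarrow> \<exists>Q. x dvd A - p2 * Q \<and> x dvd C + p1 * Q"
    and "x \<noteq> 0"
    and eq: "x * g = A * (x * u - p1) + C * (x * v - p2)"
  shows "\<exists>A' C'. g = A' * (x * u - p1) + C' * (x * v - p2)"
proof -
  have "p1 * A + C * p2 = x * (A * u + C * v - g)" using eq by (simp add: algebra_simps)
  then obtain Q where "x dvd A - p2 * Q" "x dvd C + p1 * Q" using syz[of A C] by auto
  then obtain A' C' where "A = x * A' + p2 * Q" "C = x * C' - p1 * Q"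
    by (metis dvdE diff_eq_eq eq_diff_eq)
  with eq have "x * g = x * ((A' + Q * v) * (x * u - p1) + (C' - Q * u) * (x * v - p2))"
    by (simp add: algebra_simps)
  with \<open>x \<noteq> 0\<close> show ?thesis by auto
qed

section \<open>Evaluation and induction on nested polynomial rings\<close>

text \<open>The map applies \<open>h\<close> to the coefficients and sends the variable to
  \<open>s\<close>. Using it once for Y2 and once more for Y3 yields the embedding of the surface
  into a field.\<close>

lemma poly_map_poly_hom:
  fixes h :: "'r::comm_ring_1 \<Rightarrow> 's::comm_ring_1"
  assumes add: "\<And>p q. h (p + q) = h p + h q" and mult: "\<And>p q. h (p * q) = h p * h q"
  shows poly_map_poly_pCons: "poly (map_poly h (pCons c p)) s = h c + s * poly (map_poly h p) s"
    and poly_map_poly_add: "poly (map_poly h (p + q)) s = poly (map_poly h p) s + poly (map_poly h q) s"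
    and poly_map_poly_mult: "poly (map_poly h (p * q)) s = poly (map_poly h p) s * poly (map_poly h q) s"
proof -
  have 0: "h 0 = 0" using add[of 0 0] by simp
  let ?e = "\<lambda>p. poly (map_poly h p) s"
  show pC: "?e (pCons c p) = h c + s * ?e p" for c p
    by (simp add: map_poly_pCons 0)
  show add': "?e (p + q) = ?e p + ?e q" for p q
    by (induction p q rule: poly_induct2) (simp_all only: add_pCons pC add, simp_all add: algebra_simps 0)
  have sm: "?e (smult c q) = h c * ?e q" for c q
    by (induction q) (simp_all add: pC mult algebra_simps)
  show "?e (p * q) = ?e p * ?e q"
    by (induction p) (simp_all add: pC add' sm 0 algebra_simps)
qed

lemma of_poly2_closed:
  fixes K :: "'a::field poly4 \<Rightarrow> bool"
  assumes "\<And>p q. K p \<Longrightarrow> K q \<Longrightarrow> K (p + q)" and "\<And>p q. K p \<Longrightarrow> K q \<Longrightarrow> K (p * q)"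
    and "\<And>p. K (of_polyX p)" and "K varY1"
  shows "K (of_poly2 q)"
proof (induction q)
  case 0
  show ?case using assms(3)[of 0] by simp
next
  case (pCons c q)
  have "of_poly2 (pCons c q) = of_polyX c + varY1 * of_poly2 q" by simp
  with assms pCons.IH show ?case by metis
qed

lemma of_poly3_closed:
  fixes K :: "'a::field poly4 \<Rightarrow> bool"
  assumes "\<And>p q. K p \<Longrightarrow> K q \<Longrightarrow> K (p + q)" and "\<And>p q. K p \<Longrightarrow> K q \<Longrightarrow> K (p * q)"
    and "\<And>p. K (of_polyX p)" and "K varY1" and "K varY2"
  shows "K (of_poly3 r)"
proof (induction r)
  case 0
  show ?case using assms(3)[of 0] by simp
next
  case (pCons c r)
  have "of_poly3 (pCons c r) = of_poly2 c + varY2 * of_poly3 r" by simp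
  moreover have "K (of_poly2 c)" by (rule of_poly2_closed[of K]) (fact assms)+
  ultimately show ?case using assms pCons.IH by metis
qed

text \<open>Horner decomposition, one variable at a time. The property \<open>K\<close> will be
  "some power of X times the polynomial lies in k[X, Y1] modulo the ideal", and later "the
  commutator vanishes".\<close>

lemma poly4_closed:
  fixes K :: "'a::field poly4 \<Rightarrow> bool"
  assumes "\<And>p q. K p \<Longrightarrow> K q \<Longrightarrow> K (p + q)" and "\<And>p q. K p \<Longrightarrow> K q \<Longrightarrow> K (p * q)"
    and "\<And>p. K (of_polyX p)" and "K varY1" and "K varY2" and "K varY3"
  shows "K p"
proof (induction p)
  case 0
  show ?case using assms(3)[of 0] by simp
next
  case (pCons c p)
  have "pCons c p = of_poly3 c + varY3 * p" by simp
  moreover have "K (of_poly3 c)" by (rule of_poly3_closed[of K]) (fact assms)+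
  ultimately show ?case using assms pCons.IH by metis
qed

section \<open>The defining ideal, and X as a nonzerodivisor modulo it\<close>

locale double_danielewski =
  fixes d1 d2 :: nat and P1 :: "'a::field poly2" and P2 :: "'a poly3"
  assumes d1: "d1 > 0" and d2: "d2 > 0"
    and monic1: "lead_coeff P1 = 1" and monic2: "lead_coeff P2 = 1"
begin

abbreviation "I \<equiv> dd_ideal d1 P1 d2 P2"
abbreviation "S \<equiv> dd_surface d1 P1 d2 P2"
abbreviation "cls \<equiv> dd_class d1 P1 d2 P2"

abbreviation F1 :: "'a poly4" where "F1 \<equiv> varX ^ d1 * varY2 - of_poly2 P1"
abbreviation F2 :: "'a poly4" where "F2 \<equiv> varX ^ d2 * varY3 - of_poly3 P2"

lemma ideal_I: "ideal I ring_of_type_algebra"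
proof -
  interpret cring "ring_of_type_algebra :: 'a poly4 ring" by (rule cring_from_type_algebra)
  show ?thesis unfolding dd_ideal_def by (rule genideal_ideal) (simp add: ring_of_type_algebra_def)
qed

lemma I_add: "p \<in> I \<Longrightarrow> q \<in> I \<Longrightarrow> p + q \<in> I"
  and I_mult: "q \<in> I \<Longrightarrow> p * q \<in> I"
proof -
  interpret cring "ring_of_type_algebra :: 'a poly4 ring" by (rule cring_from_type_algebra)
  interpret I: ideal I ring_of_type_algebra by (rule ideal_I)
  show "p \<in> I \<Longrightarrow> q \<in> I \<Longrightarrow> p + q \<in> I" using I.a_closed[of p q] by (simp add: ring_of_type_algebra_def)
  show "q \<in> I \<Longrightarrow> p * q \<in> I" using I.I_l_closed[of q p] by (simp add: ring_of_type_algebra_def)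
qed

lemma F_in_I: "F1 \<in> I" "F2 \<in> I"
proof -
  interpret cring "ring_of_type_algebra :: 'a poly4 ring" by (rule cring_from_type_algebra)
  show "F1 \<in> I" "F2 \<in> I" using genideal_self[of "{F1, F2}"]
    unfolding dd_ideal_def by (auto simp: ring_of_type_algebra_def)
qed

lemma I_minimal:
  assumes J: "0 \<in> J" "\<And>p q. p \<in> J \<Longrightarrow> q \<in> J \<Longrightarrow> p + q \<in> J" "\<And>p q. q \<in> J \<Longrightarrow> p * q \<in> J"
    and F: "F1 \<in> J" "F2 \<in> J"
  shows "I \<subseteq> J"
proof -
  let ?R = "ring_of_type_algebra :: 'a poly4 ring"
  interpret cring ?R by (rule cring_from_type_algebra)
  have R: "carrier ?R = UNIV" "\<And>x y. x \<oplus>\<^bsub>?R\<^esub> y = x + y" "\<And>x y. x \<otimes>\<^bsub>?R\<^esub> y = x * y" "\<zero>\<^bsub>?R\<^esub> = 0"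
    by (simp_all add: ring_of_type_algebra_def)
  \<comment> \<open>Closure under negation is an instance of closure under multiplication.\<close>
  have inv: "\<ominus>\<^bsub>?R\<^esub> x = - 1 * x" for x :: "'a poly4"
    by (rule minus_equality) (simp_all add: R)
  have "ideal J ?R"
  proof (rule idealI)
    show "subgroup J (add_monoid ?R)"
      using J by (intro add.subgroupI) (auto simp only: inv R)
    show "a \<otimes>\<^bsub>?R\<^esub> x \<in> J" if "a \<in> J" for a x
      using J(3)[OF that, of x] by (simp add: R mult.commute)
  qed (simp_all add: R J(3) ring_axioms)
  with F show ?thesis unfolding dd_ideal_def by (intro genideal_minimal) auto
qed

lemma I_iff: "p \<in> I \<longleftrightarrow> (\<exists>A C. p = A * F1 + C * F2)"
proof
  let ?J = "{p. \<exists>A C. p = A * F1 + C * F2}"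
  have "I \<subseteq> ?J"
  proof (rule I_minimal)
    show "p + q \<in> ?J" if "p \<in> ?J" "q \<in> ?J" for p q
    proof -
      obtain A C A' C' where "p = A * F1 + C * F2" "q = A' * F1 + C' * F2" using \<open>p \<in> ?J\<close> \<open>q \<in> ?J\<close> by blast
      then have "p + q = (A + A') * F1 + (C + C') * F2" by (simp only: distrib_right ac_simps)
      then show ?thesis by blast
    qed
    show "p * q \<in> ?J" if "q \<in> ?J" for p q
    proof -
      obtain A C where "q = A * F1 + C * F2" using \<open>q \<in> ?J\<close> by blast
      then have "p * q = (p * A) * F1 + (p * C) * F2" by (simp only: distrib_left mult.assoc)
      then show ?thesis by blast
    qed
    have "0 = 0 * F1 + 0 * F2" "F1 = 1 * F1 + 0 * F2" "F2 = 0 * F1 + 1 * F2"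
      by (simp_all only: mult_zero_left mult_1 add_0_left add_0_right)
    then show "0 \<in> ?J" "F1 \<in> ?J" "F2 \<in> ?J" by blast+
  qed
  then show "\<exists>A C. p = A * F1 + C * F2" if "p \<in> I" using that by blast
  show "p \<in> I" if "\<exists>A C. p = A * F1 + C * F2" using that F_in_I by (auto simp only: I_add I_mult)
qed

text \<open>X is prime in k[X, Y1] and does not divide the monic \<open>P1\<close>, so
  \<open>P1\<close> is a nonzerodivisor modulo X; \<open>P2\<close> is monic in Y2. The syzygy
  lemmas therefore apply to \<open>P1\<close> and \<open>P2\<close>.\<close>

lemma varX_nonzerodivisor:
  assumes "varX * g \<in> I"
  shows "g \<in> I"
proof -
  \<comment> \<open>Both exponents are positive, so each generator has the shape
    \<open>x * u - p\<close> that the division lemma expects.\<close>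
  have dX: "varX ^ d1 = varX * varX ^ (d1 - 1)" "varX ^ d2 = varX * varX ^ (d2 - 1)"
    using d1 d2 by (simp_all only: power_eq_if[of _ d1] power_eq_if[of _ d2]) simp_all
  have "prime_elem [:0, 1::'a:]" by (rule prime_elem_linear_field_poly) simp
  then have prime: "prime_elem [:[:0, 1::'a:]:]" by (rule lift_prime_elem_poly)
  have "\<not> [:0, 1::'a:] dvd lead_coeff P1" unfolding monic1 by (simp add: is_unit_iff_degree)
  then have "\<not> [:[:0, 1::'a:]:] dvd P1" unfolding const_poly_dvd_iff by blast
  then have reg: "[:[:0, 1::'a:]:] dvd P1 * r \<Longrightarrow> [:[:0, 1::'a:]:] dvd r" for r
    using prime by (simp add: prime_elem_dvd_mult_iff)
  obtain A C where "varX * g = A * F1 + C * F2" using assms unfolding I_iff by blast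
  then have "\<exists>A C. g = A * F1 + C * F2"
    unfolding dX mult.assoc
    by (intro koszul_division[OF syzygy_mod_const2[OF reg monic2]]) simp_all
  then show ?thesis unfolding I_iff .
qed

lemma varX_power_nonzerodivisor: "varX ^ m * g \<in> I \<Longrightarrow> g \<in> I"
  by (induction m) (use varX_nonzerodivisor in \<open>simp_all only: power_Suc power_0 mult_1 mult.assoc\<close>)

section \<open>The embedding into the fraction field of k[X, Y1]\<close>

text \<open>Y2 goes to the value that the first relation forces once X is inverted;
  \<open>embed\<close> treats Y3 in the same way. The target is the whole fraction field instead of
  k[X, 1/X, Y1], so that division is available.\<close>

definition embed3 :: "'a poly3 \<Rightarrow> 'a poly2 fract" where
  "embed3 r = poly (map_poly to_fract r) (to_fract P1 / to_fract [:[:0, 1:]:] ^ d1)"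

definition embed :: "'a poly4 \<Rightarrow> 'a poly2 fract" where
  "embed p = poly (map_poly embed3 p) (embed3 P2 / to_fract [:[:0, 1:]:] ^ d2)"

lemma embed3_add: "embed3 (p + q) = embed3 p + embed3 q"
  and embed3_mult: "embed3 (p * q) = embed3 p * embed3 q"
  unfolding embed3_def by (simp_all add: poly_map_poly_add poly_map_poly_mult)

lemma embed3_0: "embed3 0 = 0"
  by (simp add: embed3_def)

lemma embed_add: "embed (p + q) = embed p + embed q"
  and embed_mult: "embed (p * q) = embed p * embed q"
  unfolding embed_def
  by (simp_all only: poly_map_poly_add[OF embed3_add embed3_mult]
      poly_map_poly_mult[OF embed3_add embed3_mult])

lemma embed_diff: "embed (p - q) = embed p - embed q"
  using embed_add[of "p - q" q] by (simp only: diff_add_cancel eq_diff_eq)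

lemma embed_of_poly2: "embed (of_poly2 q) = to_fract q"
  by (simp add: embed_def embed3_def map_poly_pCons embed3_0)

lemma embed_0: "embed 0 = 0" and embed_1: "embed 1 = 1"
  using embed_of_poly2[of 0] embed_of_poly2[of 1] by (simp_all flip: one_pCons)

lemma embed_power: "embed (p ^ m) = embed p ^ m"
  by (induction m) (simp_all only: power_0 power_Suc embed_mult embed_1)

lemma embed_varX: "embed varX = to_fract [:[:0, 1:]:]"
  by (rule embed_of_poly2)

lemma embed_varX_nonzero: "embed varX \<noteq> 0"
  unfolding embed_varX by simp

lemma embed_F: "embed F1 = 0" "embed F2 = 0"
proof -
  have 3: "embed (of_poly3 r) = embed3 r" for r by (simp add: embed_def map_poly_pCons embed3_0)
  have [simp]: "embed3 1 = 1" by (simp add: embed3_def)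
  have "embed varY2 = to_fract P1 / embed varX ^ d1"
    unfolding 3 embed_varX by (simp add: embed3_def map_poly_pCons)
  then show "embed F1 = 0" unfolding embed_diff embed_mult embed_power embed_of_poly2[of P1]
    using embed_varX_nonzero by (simp only: times_divide_eq_right nonzero_mult_div_cancel_left power_not_zero diff_self simp_thms)
  have "embed varY3 = embed3 P2 / embed varX ^ d2"
    unfolding embed_varX by (simp add: embed_def map_poly_pCons embed3_0)
  then show "embed F2 = 0" unfolding embed_diff embed_mult embed_power 3[of P2]
    using embed_varX_nonzero by (simp only: times_divide_eq_right nonzero_mult_div_cancel_left power_not_zero diff_self simp_thms)
qed

text \<open>The property passes to sums and products by multiplying out the powers of X, and
  \<open>F1\<close> and \<open>F2\<close> provide it for Y2 and Y3.\<close>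

lemma localization: "\<exists>m r. varX ^ m * p - of_poly2 r \<in> I"
proof -
  let ?K = "\<lambda>p. \<exists>m r. varX ^ m * p - of_poly2 r \<in> I"
  have hom: "of_poly2 (r + s) = of_poly2 r + of_poly2 s" "of_poly2 (r * s) = of_poly2 r * of_poly2 s"
     "of_poly2 ([:[:0, 1:]:] ^ m) = varX ^ m" for r s :: "'a poly2" and m
    by (simp_all add: poly_const_pow)
  have add: "?K (p + q)" and mult: "?K (p * q)" if "?K p" "?K q" for p q
  proof -
    from that obtain m r m' r' where mr: "varX ^ m * p - of_poly2 r \<in> I" "varX ^ m' * q - of_poly2 r' \<in> I"
      by blast
    have "varX ^ m' * (varX ^ m * p - of_poly2 r) + varX ^ m * (varX ^ m' * q - of_poly2 r') \<in> I"
      by (intro I_add I_mult mr)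
    also have "varX ^ m' * (varX ^ m * p - of_poly2 r) + varX ^ m * (varX ^ m' * q - of_poly2 r') =
        varX ^ (m + m') * (p + q) - of_poly2 ([:[:0, 1:]:] ^ m' * r + [:[:0, 1:]:] ^ m * r')"
      unfolding hom power_add by (simp only: algebra_simps)
    finally show "?K (p + q)" by blast
    have "varX ^ m' * q * (varX ^ m * p - of_poly2 r) + of_poly2 r * (varX ^ m' * q - of_poly2 r') \<in> I"
      by (intro I_add I_mult mr)
    also have "varX ^ m' * q * (varX ^ m * p - of_poly2 r) + of_poly2 r * (varX ^ m' * q - of_poly2 r') =
        varX ^ (m + m') * (p * q) - of_poly2 (r * r')"
      unfolding hom power_add by (simp only: algebra_simps diff_add_cancel add_diff_eq)
    finally show "?K (p * q)" by blast
  qed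
  have "0 \<in> I" using I_mult[OF F_in_I(1), of 0] by (simp only: mult_zero_left)
  then have "varX ^ 0 * of_poly2 q - of_poly2 q \<in> I" for q
    by (simp only: power_0 mult_1 diff_self)
  then have poly2: "?K (of_poly2 q)" for q by blast
  have Y2: "?K varY2" using F_in_I(1) by blast
  \<comment> \<open>\<open>F2\<close> rewrites \<open>varX ^ d2 * varY3\<close> as
    \<open>P2\<close>, which may still involve Y2, so a further power of X has to bring
    \<open>P2\<close> into k[X, Y1].\<close>
  have "?K (of_poly3 P2)"
    by (rule of_poly3_closed[where K = ?K]) (fact add mult poly2 Y2)+
  then obtain m r where mr: "varX ^ m * of_poly3 P2 - of_poly2 r \<in> I" by blast
  have "varX ^ m * F2 + (varX ^ m * of_poly3 P2 - of_poly2 r) \<in> I"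
    by (intro I_add I_mult mr F_in_I)
  also have "varX ^ m * F2 + (varX ^ m * of_poly3 P2 - of_poly2 r) = varX ^ (m + d2) * varY3 - of_poly2 r"
    unfolding power_add by (simp only: algebra_simps diff_add_cancel add_diff_eq)
  finally have Y3: "?K varY3" by blast
  show ?thesis
    by (rule poly4_closed[where K = ?K]) (fact add mult poly2 Y2 Y3)+
qed

text \<open>For the kernel: a power of X brings \<open>p\<close> to some \<open>r\<close> in
  k[X, Y1] modulo \<open>I\<close>. There \<open>embed\<close> is injective, so
  \<open>r = 0\<close>, and the power of X cancels because X is a nonzerodivisor modulo
  \<open>I\<close>.\<close>

lemma embed_eq_0_iff: "embed p = 0 \<longleftrightarrow> p \<in> I"
proof
  have zero: "embed q = 0" if "q \<in> I" for q
    using that unfolding I_iff by (auto simp only: embed_add embed_mult embed_F mult_zero_right add_0_left)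
  then show "p \<in> I \<Longrightarrow> embed p = 0" .
  assume "embed p = 0"
  obtain m r where mr: "varX ^ m * p - of_poly2 r \<in> I" using localization by blast
  from zero[OF this] \<open>embed p = 0\<close> have "to_fract r = 0"
    unfolding embed_diff embed_mult embed_of_poly2[of r] by (simp only: mult_zero_right) simp
  then have "of_poly2 r = 0" by simp
  with mr have "varX ^ m * p \<in> I" by (simp only: diff_0_right)
  then show "p \<in> I" by (rule varX_power_nonzerodivisor)
qed

text \<open>Equations between cosets become equations in a field, where nonzero factors can be
  cancelled.\<close>

lemma class_eq_iff: "cls p = cls q \<longleftrightarrow> embed p = embed q"
proof -
  let ?R = "ring_of_type_algebra :: 'a poly4 ring"
  interpret cring ?R by (rule cring_from_type_algebra)
  have R: "carrier ?R = UNIV" "\<And>x y. x \<oplus>\<^bsub>?R\<^esub> y = x + y" "\<zero>\<^bsub>?R\<^esub> = 0"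
    by (simp_all add: ring_of_type_algebra_def)
  have "\<ominus>\<^bsub>?R\<^esub> x = - x" for x :: "'a poly4" by (rule minus_equality) (simp_all add: R)
  then have "p \<ominus>\<^bsub>?R\<^esub> q = p - q" by (simp add: a_minus_def R)
  then have "cls p = cls q \<longleftrightarrow> p - q \<in> I"
    using quotient_eq_iff_same_a_r_cos[OF ideal_I, of p q] unfolding dd_class_def R by simp
  then show ?thesis by (simp only: embed_eq_0_iff[symmetric] embed_diff right_minus_eq)
qed

lemma carrier_S: "carrier S = range cls"
  by (auto simp: dd_surface_def dd_class_def FactRing_def A_RCOSETS_def' ring_of_type_algebra_def)

lemma class_mult: "cls p \<otimes>\<^bsub>S\<^esub> cls q = cls (p * q)"
  and class_add: "cls p \<oplus>\<^bsub>S\<^esub> cls q = cls (p + q)"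
proof -
  note hom = ideal.rcos_ring_hom[OF ideal_I]
  show "cls p \<otimes>\<^bsub>S\<^esub> cls q = cls (p * q)"
    using ring_hom_mult[OF hom, of p q] by (simp add: dd_class_def dd_surface_def ring_of_type_algebra_def)
  show "cls p \<oplus>\<^bsub>S\<^esub> cls q = cls (p + q)"
    using ring_hom_add[OF hom, of p q] by (simp add: dd_class_def dd_surface_def ring_of_type_algebra_def)
qed

section \<open>The commutator of the automorphism and the derivation\<close>

text \<open>The polynomial \<open>f\<close> is arbitrary and the condition runs over all its
  coefficients, so one statement serves both the given sum of monomials and the case
  \<open>f = 1\<close>.\<close>

lemma automorphism_commutes_iff:
  fixes \<alpha> :: "'a poly4 set \<Rightarrow> 'a poly4 set" and f b :: "'a poly" and lam a :: 'a
  defines "\<delta> \<equiv> \<lambda>u. cls (of_polyX f) \<otimes>\<^bsub>S\<^esub> dd_lnd d1 P1 d2 P2 u"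
  assumes deriv: "pderiv P1 \<noteq> 0"
    and \<alpha>: "\<alpha> \<in> dd_Aut d1 P1 d2 P2"
    and \<alpha>_x: "\<alpha> (cls varX) = cls (of_polyX [:lam:]) \<otimes>\<^bsub>S\<^esub> cls varX"
    and \<alpha>_y1: "\<alpha> (cls varY1) = cls (of_polyX [:a:]) \<otimes>\<^bsub>S\<^esub> cls varY1 \<oplus>\<^bsub>S\<^esub> cls (of_polyX b)"
    and lam: "lam \<noteq> 0"
  shows "\<delta> (\<alpha> (cls varY1)) = \<alpha> (\<delta> (cls varY1)) \<longleftrightarrow> (\<forall>m. a * coeff f m = lam ^ (d1 + d2 + m) * coeff f m)"
    and "\<delta> (\<alpha> (cls varY2)) = \<alpha> (\<delta> (cls varY2)) \<longleftrightarrow> \<delta> (\<alpha> (cls varY1)) = \<alpha> (\<delta> (cls varY1))"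
    and "\<alpha> \<in> dd_Aut_der d1 P1 d2 P2 \<delta> \<longleftrightarrow> \<delta> (\<alpha> (cls varY1)) = \<alpha> (\<delta> (cls varY1))"
proof -
  have hom: "\<alpha> \<in> ring_hom S S" and bij: "bij_betw \<alpha> (carrier S) (carrier S)"
    and const: "\<And>c. \<alpha> (cls (of_polyX [:c:])) = cls (of_polyX [:c:])"
    using \<alpha> unfolding dd_Aut_def ring_iso_def by blast+
  have "\<exists>q. \<alpha> (cls p) = cls q" for p
    using bij unfolding carrier_S bij_betw_def by blast
  \<comment> \<open>\<open>A\<close> merely chooses representatives and need not be additive or
    multiplicative; only its composition \<open>T\<close> with \<open>embed\<close> is known to be a
    homomorphism.\<close>
  then obtain A where A: "\<And>p. \<alpha> (cls p) = cls (A p)" by metis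
  define T where "T p = embed (A p)" for p
  have T_add: "T (p + q) = T p + T q" for p q
    using ring_hom_add[OF hom, of "cls p" "cls q"]
    by (simp only: carrier_S rangeI A class_add class_eq_iff T_def embed_add simp_thms)
  have T_mult: "T (p * q) = T p * T q" for p q
    using ring_hom_mult[OF hom, of "cls p" "cls q"]
    by (simp only: carrier_S rangeI A class_mult class_eq_iff T_def embed_mult simp_thms)
  have T_eq_iff: "T p = T q \<longleftrightarrow> embed p = embed q" for p q
    using bij inj_on_eq_iff[of \<alpha> "carrier S" "cls p" "cls q"] unfolding bij_betw_def carrier_S
    by (simp only: rangeI A class_eq_iff T_def simp_thms)
  have T_0: "T 0 = 0" using T_add[of 0 0] by (metis add_0 add_cancel_right_right)
  have T_X: "T varX = embed (of_polyX [:lam:] * varX)"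
    using \<alpha>_x by (simp only: A class_mult class_eq_iff T_def)
  have T_Y1: "T varY1 = embed (of_polyX [:a:] * varY1 + of_polyX b)"
    using \<alpha>_y1 by (simp only: A class_mult class_add class_eq_iff T_def)
  have T_const: "T (of_polyX [:c:]) = embed (of_polyX [:c:])" for c
    using const by (simp only: A class_eq_iff T_def)
  have T_polyX: "T (of_polyX p) = embed (of_polyX (pcompose p [:0, lam:]))" for p
  proof (induction p)
    case 0
    show ?case using T_0 by (simp add: embed_0)
  next
    case (pCons c p)
    have "of_polyX (pCons c p) = of_polyX [:c:] + varX * of_polyX p" by simp
    moreover have "of_polyX (pcompose (pCons c p) [:0, lam:]) =
        of_polyX [:c:] + of_polyX [:lam:] * varX * of_polyX (pcompose p [:0, lam:])"
      by (simp add: pcompose_pCons)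
    ultimately show ?case
      by (simp only: T_add T_mult T_const T_X pCons.IH embed_add embed_mult)
  qed

  define L where "L p = of_polyX f * dd_lift d1 P1 d2 P2 p" for p
  have L_add: "L (p + q) = L p + L q" and L_mult: "L (p * q) = p * L q + L p * q" for p q
    unfolding L_def dd_lift_add dd_lift_mult by (simp_all only: algebra_simps)
  have \<delta>_cls: "\<delta> (cls p) = cls (L p)" for p
    by (simp only: \<delta>_def dd_lnd_class class_mult L_def)
  \<comment> \<open>This is the well-definedness of \<delta> on cosets, transported to the
    field.\<close>
  have L_cong: "embed (L p) = embed (L q)" if "embed p = embed q" for p q
    using that \<delta>_cls unfolding class_eq_iff[symmetric] by metis

  \<comment> \<open>The value in the field of \<alpha>\<delta> - \<delta>\<alpha>. It obeys the
    Leibniz rule twisted by \<open>T\<close>; in \<open>E_add\<close> and \<open>E_mult\<close>,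
    \<open>LA_cong\<close> replaces the chosen representative of a sum or product by the sum or
    product of the chosen ones.\<close>
  define E where "E p = T (L p) - embed (L (A p))" for p
  have E_iff: "\<delta> (\<alpha> (cls p)) = \<alpha> (\<delta> (cls p)) \<longleftrightarrow> E p = 0" for p
    unfolding A \<delta>_cls class_eq_iff E_def T_def by auto
  have LA_cong: "embed (L (A p)) = embed (L q)" if "T p = embed q" for p q
    using L_cong that unfolding T_def .
  have E_cong: "E p = E q" if "embed p = embed q" for p q
    using that L_cong[of p q] L_cong[of "A p" "A q"] T_eq_iff unfolding E_def T_def by metis
  have E_add: "E (p + q) = E p + E q" for p q
  proof -
    have "embed (L (A (p + q))) = embed (L (A p + A q))"
      by (rule LA_cong) (simp only: T_add embed_add, simp only: T_def)
    then show ?thesis unfolding E_def L_add T_add embed_add by simp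
  qed
  have E_mult: "E (p * q) = T p * E q + E p * T q" for p q
  proof -
    have "embed (L (A (p * q))) = embed (L (A p * A q))"
      by (rule LA_cong) (simp only: T_mult embed_mult, simp only: T_def)
    then show ?thesis unfolding E_def L_mult L_add T_add T_mult embed_add embed_mult
      by (simp add: T_def algebra_simps)
  qed
  have L_polyX: "L (of_polyX p) = 0" for p
    unfolding L_def dd_lift_consts(1) by (rule mult_zero_right)
  have E_polyX: "E (of_polyX p) = 0" for p
    using LA_cong[OF T_polyX[of p]] by (simp only: E_def L_polyX T_0 embed_0 diff_self)
  have E_X_power: "E (varX ^ m) = 0" for m
    using E_polyX[of "[:0, 1:] ^ m"] by (simp only: poly_const_pow)
  have T_X_power: "T (varX ^ m) \<noteq> 0" for m
    using T_eq_iff[of "varX ^ m" 0] embed_varX_nonzero by (simp only: T_0 embed_0 embed_power power_not_zero simp_thms)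
  \<comment> \<open>The chain rule, as \<open>E\<close> kills k[x].\<close>
  have E_poly2: "E (of_poly2 q) = T (of_poly2 (pderiv q)) * E varY1" for q
  proof (induction q)
    case 0
    show ?case using E_polyX[of 0] T_0 by simp
  next
    case (pCons c q)
    have "of_poly2 (pCons c q) = of_polyX c + varY1 * of_poly2 q"
      "of_poly2 (pderiv (pCons c q)) = of_poly2 q + varY1 * of_poly2 (pderiv q)"
      by (simp_all add: pderiv_pCons)
    then show ?case
      by (simp only: E_add E_mult E_polyX T_add T_mult pCons.IH algebra_simps add_0_left)
  qed

  \<comment> \<open>\<alpha> is injective, and so is \<open>embed\<close> on k[X, Y1].\<close>
  have T_deriv: "T (of_poly2 (pderiv P1)) \<noteq> 0"
    using T_eq_iff[of "of_poly2 (pderiv P1)" 0] deriv by (simp add: T_0 embed_0 embed_of_poly2)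
  have "E (varX ^ d1 * varY2) = E (of_poly2 P1)"
    using embed_F(1) by (intro E_cong) (simp only: embed_diff right_minus_eq)
  then have "T (varX ^ d1) * E varY2 = T (of_poly2 (pderiv P1)) * E varY1"
    by (simp only: E_mult E_X_power E_poly2[of P1] mult_zero_left add_0_right)
  then have Y2: "E varY2 = 0 \<longleftrightarrow> E varY1 = 0"
    using T_X_power T_deriv by (metis mult_eq_0_iff)
  then show "\<delta> (\<alpha> (cls varY2)) = \<alpha> (\<delta> (cls varY2)) \<longleftrightarrow> \<delta> (\<alpha> (cls varY1)) = \<alpha> (\<delta> (cls varY1))"
    unfolding E_iff .

  have E_all: "E p = 0" if "E varY1 = 0" for p
  proof -
    have add: "E (p + q) = 0" and mult: "E (p * q) = 0" if "E p = 0" "E q = 0" for p q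
      using that by (simp_all only: E_add E_mult mult_zero_left mult_zero_right add_0_left)
    note Y12 = that that[folded Y2]
    have "E (of_poly3 P2) = 0"
      by (rule of_poly3_closed[where K = "\<lambda>p. E p = 0"]) (fact add mult E_polyX Y12)+
    moreover have "E (varX ^ d2 * varY3) = E (of_poly3 P2)"
      using embed_F(2) by (intro E_cong) (simp only: embed_diff right_minus_eq)
    ultimately have "T (varX ^ d2) * E varY3 = 0"
      by (simp only: E_mult E_X_power mult_zero_left add_0_right)
    then have Y3: "E varY3 = 0" using T_X_power by (metis mult_eq_0_iff)
    show ?thesis
      by (rule poly4_closed[where K = "\<lambda>p. E p = 0"]) (fact add mult E_polyX Y12 Y3)+
  qed
  show "\<alpha> \<in> dd_Aut_der d1 P1 d2 P2 \<delta> \<longleftrightarrow> \<delta> (\<alpha> (cls varY1)) = \<alpha> (\<delta> (cls varY1))"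
  proof -
    have "\<alpha> \<in> dd_Aut_der d1 P1 d2 P2 \<delta> \<longleftrightarrow> (\<forall>p. \<alpha> (\<delta> (cls p)) = \<delta> (\<alpha> (cls p)))"
      using \<alpha> unfolding dd_Aut_der_def carrier_S by blast
    also have "\<dots> \<longleftrightarrow> (\<forall>p. E p = 0)" by (metis E_iff)
    also have "\<dots> \<longleftrightarrow> E varY1 = 0" using E_all by blast
    finally show ?thesis unfolding E_iff .
  qed

  \<comment> \<open>\<open>g\<close> represents \<delta>(y1). Since \<delta> kills \<open>b\<close>,
    the commutator at y1 is g(lam x) - a g(x), a polynomial in x alone.\<close>
  define g where "g = monom 1 (d1 + d2) * f"
  have g_X: "of_polyX f * varX ^ (d1 + d2) = of_polyX g"
    by (simp only: poly_const_pow) (simp add: g_def monom_altdef)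
  have "E varY1 = embed (of_polyX (pcompose g [:0, lam:])) - embed (of_polyX [:a:] * of_polyX g)"
    using LA_cong[OF T_Y1]
    by (simp only: E_def L_add L_mult L_polyX mult_zero_left add_0_right L_def[of varY1] dd_lift_vars(2) g_X T_polyX)
  also have "\<dots> = to_fract [:pcompose g [:0, lam:] - smult a g:]"
    by (simp add: embed_of_poly2 flip: to_fract_diff)
  finally have "E varY1 = 0 \<longleftrightarrow> pcompose g [:0, lam:] = smult a g" by simp
  also have "pcompose g [:0, lam:] = smult a g \<longleftrightarrow>
      (\<forall>m. a * coeff f m = lam ^ (d1 + d2 + m) * coeff f m)"
  proof -
    have "(\<forall>j. lam ^ j * coeff (monom 1 d * f) j = a * coeff (monom 1 d * f) j) \<longleftrightarrow>
        (\<forall>m. a * coeff f m = lam ^ (d + m) * coeff f m)" for d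
    proof (intro iffI allI)
      show "a * coeff f m = lam ^ (d + m) * coeff f m"
        if "\<forall>j. lam ^ j * coeff (monom 1 d * f) j = a * coeff (monom 1 d * f) j" for m
        using that[rule_format, of "d + m"] by (auto simp: coeff_monom_mult)
      show "lam ^ j * coeff (monom 1 d * f) j = a * coeff (monom 1 d * f) j"
        if "\<forall>m. a * coeff f m = lam ^ (d + m) * coeff f m" for j
        \<comment> \<open>For \<open>j < d\<close> the truncated difference is irrelevant, because
          coefficient \<open>j\<close> of the product is zero.\<close>
        using that[rule_format, of "j - d"] by (auto simp: coeff_monom_mult)
    qed
    then show ?thesis by (auto simp add: g_def poly_eq_iff coeff_pcompose_linear)
  qed
  finally show "\<delta> (\<alpha> (cls varY1)) = \<alpha> (\<delta> (cls varY1)) \<longleftrightarrow> (\<forall>m. a * coeff f m = lam ^ (d1 + d2 + m) * coeff f m)"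
    unfolding E_iff .
qed

end

section \<open>The equivalences for a sum of monomials and for the canonical derivation\<close>

theorem proposition8p3:
  fixes d1 d2 l :: nat
    and P1 :: "'a::field_char_0 poly poly" and P2 :: "'a poly poly poly"
    and f b :: "'a poly" and c :: "nat \<Rightarrow> 'a" and n :: "nat \<Rightarrow> nat"
    and lam a :: 'a
    and B (structure)
    and cls :: "'a poly poly poly poly \<Rightarrow> 'a poly poly poly poly set"
    and D \<delta> \<alpha> :: "'a poly poly poly poly set \<Rightarrow> 'a poly poly poly poly set"
  assumes d: "d1 \<ge> 2" "d2 \<ge> 2"
    and P1: "lead_coeff P1 = 1" "degree P1 \<ge> 2"
    and P2: "lead_coeff P2 = 1" "degree P2 \<ge> 2"
    and f: "f = (\<Sum>i\<le>l. Polynomial.monom (c i) (n i))" "inj_on n {..l}" "\<And>i. i \<le> l \<Longrightarrow> c i \<noteq> 0"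
    and B: "B = dd_surface d1 P1 d2 P2"
    and cls: "cls = dd_class d1 P1 d2 P2"
    and D: "D = dd_lnd d1 P1 d2 P2"
    and \<delta>: "\<delta> = (\<lambda>u. cls (of_polyX f) \<otimes> D u)"
    and \<alpha>: "\<alpha> \<in> dd_Aut d1 P1 d2 P2"
    and \<alpha>_x: "\<alpha> (cls varX) = cls (of_polyX [:lam:]) \<otimes> cls varX"
    and \<alpha>_y1: "\<alpha> (cls varY1) = cls (of_polyX [:a:]) \<otimes> cls varY1 \<oplus> cls (of_polyX b)"
    and nz: "lam \<noteq> 0" "a \<noteq> 0"
  shows "(\<alpha> \<in> dd_Aut_der d1 P1 d2 P2 \<delta> \<longleftrightarrow> \<delta> (\<alpha> (cls varY1)) = \<alpha> (\<delta> (cls varY1)))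
       \<and> (\<alpha> \<in> dd_Aut_der d1 P1 d2 P2 \<delta> \<longleftrightarrow> \<delta> (\<alpha> (cls varY2)) = \<alpha> (\<delta> (cls varY2)))
       \<and> (\<alpha> \<in> dd_Aut_der d1 P1 d2 P2 \<delta> \<longleftrightarrow>
            a = lam ^ (d1 + d2 + n 0) \<and> (\<forall>i\<in>{1..l}. lam ^ (d1 + d2 + n 0) = lam ^ (d1 + d2 + n i)))
       \<and> (\<alpha> \<in> dd_Aut_der d1 P1 d2 P2 D \<longleftrightarrow> a = lam ^ (d1 + d2))"
proof -
  interpret dd: double_danielewski d1 d2 P1 P2
    by unfold_locales (use d P1 P2 in simp_all)
  \<comment> \<open>In characteristic zero a nonconstant polynomial has nonzero derivative.\<close>
  have deriv: "pderiv P1 \<noteq> 0" using P1 by (simp add: pderiv_eq_0_iff)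
  note commutes = dd.automorphism_commutes_iff[OF deriv \<alpha> \<alpha>_x[unfolded B cls] \<alpha>_y1[unfolded B cls] nz(1)]
  have coeff_f: "coeff f m = (\<Sum>i\<le>l. if n i = m then c i else 0)" for m
    by (simp add: f(1) coeff_sum)
  have "coeff f (n i) = c i" if "i \<le> l" for i
  proof -
    have "coeff f (n i) = (\<Sum>j\<le>l. if j = i then c j else 0)"
      unfolding coeff_f using f(2) that by (intro sum.cong) (auto simp: inj_on_def)
    then show ?thesis using that by simp
  qed
  moreover have "coeff f m = 0" if "m \<notin> n ` {..l}" for m
    unfolding coeff_f using that by (intro sum.neutral) auto
  \<comment> \<open>Distinct exponents keep the terms from merging: at \<open>m = n i\<close> the
    nonzero \<open>c i\<close> cancels, and at any other \<open>m\<close> both sides are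
    zero.\<close>
  ultimately have "a * coeff f m = lam ^ (d1 + d2 + m) * coeff f m \<longleftrightarrow>
      (\<forall>i\<le>l. n i = m \<longrightarrow> a = lam ^ (d1 + d2 + m))" for m
    using f(3) by (cases "m \<in> n ` {..l}") auto
  then have "(\<forall>m. a * coeff f m = lam ^ (d1 + d2 + m) * coeff f m) \<longleftrightarrow>
      (\<forall>i\<in>{..l}. a = lam ^ (d1 + d2 + n i))"
    by auto
  also have "{..l} = insert 0 {1..l}" by auto
  also have "(\<forall>i\<in>insert 0 {1..l}. a = lam ^ (d1 + d2 + n i)) \<longleftrightarrow> a = lam ^ (d1 + d2 + n 0) \<and>
      (\<forall>i\<in>{1..l}. lam ^ (d1 + d2 + n 0) = lam ^ (d1 + d2 + n i))"
    by auto
  finally have iv: "(\<forall>m. a * coeff f m = lam ^ (d1 + d2 + m) * coeff f m) \<longleftrightarrow> \<dots>" .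

  \<comment> \<open>The canonical derivation is the case \<open>f = 1\<close>. The two maps are
    compared on the carrier only, which suffices because \<alpha> maps the carrier to
    itself.\<close>
  let ?D1 = "\<lambda>u. dd.cls (of_polyX 1) \<otimes>\<^bsub>dd.S\<^esub> dd_lnd d1 P1 d2 P2 u"
  have D_eq: "D u = ?D1 u" if "u \<in> carrier dd.S" for u
    using that unfolding dd.carrier_S
    by (auto simp: D dd_lnd_class dd.class_mult simp flip: one_pCons)
  have \<alpha>_closed: "\<alpha> u \<in> carrier dd.S" if "u \<in> carrier dd.S" for u
    using \<alpha> that unfolding dd_Aut_def ring_iso_def by (auto dest: bij_betwE)
  have "\<alpha> (D u) = D (\<alpha> u) \<longleftrightarrow> \<alpha> (?D1 u) = ?D1 (\<alpha> u)" if "u \<in> carrier dd.S" for u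
    unfolding D_eq[OF that] D_eq[OF \<alpha>_closed[OF that]] ..
  then have "\<alpha> \<in> dd_Aut_der d1 P1 d2 P2 D \<longleftrightarrow> \<alpha> \<in> dd_Aut_der d1 P1 d2 P2 ?D1"
    unfolding dd_Aut_der_def by blast
  also have "\<dots> \<longleftrightarrow> a = lam ^ (d1 + d2)"
    \<comment> \<open>For \<open>f = 1\<close> only the coefficient at 0 imposes a
      condition.\<close>
    unfolding commutes(1,3)[of 1] by (auto simp: coeff_1 dest: spec[of _ 0] intro!: gr0I)
  finally have D_iff: "\<alpha> \<in> dd_Aut_der d1 P1 d2 P2 D \<longleftrightarrow> a = lam ^ (d1 + d2)" .
  show ?thesis
    using commutes[of f, folded D B cls, folded \<delta>] unfolding iv by (simp only: D_iff fun_cong[OF \<delta>])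
qed

end
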